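(* Let $\beta,\alpha$ be two non-negative increasing sequences that tend to infinity. Assume that there exist $A,B>0$ such that $\alpha_n\le A\beta_n+B$ for all $n\in\mathbb{N}$. Then, for every $\theta=(\theta_n)_{n\in\mathbb{N}_0}\in\Lambda_\infty(\beta)$, the Hankel operator $H_\theta:\Lambda_1(\alpha)\to\Lambda_\infty(\beta)$ is well-defined, continuous and compact.
   Context: $\mathbb{N}=\{1,2,\dots\}$, $\mathbb{N}_0=\mathbb{N}\cup\{0\}$. For a non-negative increasing sequence $\alpha=(\alpha_n)_{n\in\mathbb{N}}$ with $\alpha_n\to\infty$, the power series space of finite type is the Fréchet space $\Lambda_1(\alpha)=\{x=(x_n)_{n\in\mathbb{N}}:\ \|x\|_k:=\sum_{n=1}^\infty|x_n|e^{-\frac1k\alpha_n}<\infty\ \text{for all }k\in\mathbb{N}\}$, and the power series space of infinite type is the Fréchet space $\Lambda_\infty(\alpha)=\{x=(x_n)_{n\in\mathbb{N}}:\ \|x\|_k:=\sum_{n=1}^\infty|x_n|e^{k\alpha_n}<\infty\ \text{for all }k\in\mathbb{N}\}$, each with the seminorms $\|\cdot\|_k$, $k\in\mathbb{N}$. The sequence $e_n$ has $1$ in the $n$-th place and $0$ elsewhere. A sequence $\theta=(\theta_n)_{n\in\mathbb{N}_0}$ is identified with the sequence $(\theta_{n-1})_{n\in\mathbb{N}}=(\theta_0,\theta_1,\theta_2,\dots)$ when it is said to belong to a sequence space. The Hankel operator $H_\theta:E\to F$ between such sequence spaces is given by $H_\theta e_n=(\theta_{n-1},\theta_n,\theta_{n+1},\dots)=\sum_{j=1}^\infty\theta_{j+n-2}e_j$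 for $n\in\mathbb{N}$ and $H_\theta x=\sum_{n=1}^\infty x_nH_\theta e_n$ for $x=(x_n)\in E$. It is well-defined if $H_\theta e_n\in F$ for all $n$ and the series $\sum_n x_nH_\theta e_n$ converges in $F$ for every $x\in E$. A linear map $T:E\to F$ between Fréchet spaces is compact if $T(U)$ is precompact in $F$ for some neighborhood $U$ of zero in $E$. *)

theory Defs
  imports "HOL-Analysis.Analysis"
begin

text \<open>
  A sequence \<open>(x\<^sub>n)\<close> indexed by the positive integers is stored as a function on \<^typ>\<open>nat\<close>
  whose value at \<open>n\<close> is the \<open>(n + 1)\<close>-st term; this applies to elements of the sequence spaces and
  to the exponent sequences \<open>\<alpha>\<close>, \<open>\<beta>\<close>. A sequence \<open>(\<theta>\<^sub>n)\<close> starting at \<open>n = 0\<close> is stored with its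
  own indices, so that its identification with \<open>(\<theta>\<^sub>0, \<theta>\<^sub>1, \<dots>)\<close> is the identity.
  The seminorm index \<open>k\<close> is not shifted and ranges over \<open>k \<ge> 1\<close>.

  The scalar field is left polymorphic, so that both the real and the complex case are covered.
\<close>

definition fin_seminorm :: "(nat \<Rightarrow> real) \<Rightarrow> nat \<Rightarrow> (nat \<Rightarrow> 'a::real_normed_field) \<Rightarrow> real" where
  "fin_seminorm \<alpha> k x = (\<Sum>n. norm (x n) * exp (- (1 / real k) * \<alpha> n))"

definition fin_power_series_space :: "(nat \<Rightarrow> real) \<Rightarrow> (nat \<Rightarrow> 'a::real_normed_field) set" where
  "fin_power_series_space \<alpha> =
    {x. \<forall>k\<ge>1. summable (\<lambda>n. norm (x n) * exp (- (1 / real k) * \<alpha> n))}"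

definition inf_seminorm :: "(nat \<Rightarrow> real) \<Rightarrow> nat \<Rightarrow> (nat \<Rightarrow> 'a::real_normed_field) \<Rightarrow> real" where
  "inf_seminorm \<alpha> k x = (\<Sum>n. norm (x n) * exp (real k * \<alpha> n))"

definition inf_power_series_space :: "(nat \<Rightarrow> real) \<Rightarrow> (nat \<Rightarrow> 'a::real_normed_field) set" where
  "inf_power_series_space \<alpha> =
    {x. \<forall>k\<ge>1. summable (\<lambda>n. norm (x n) * exp (real k * \<alpha> n))}"

definition seminorm_topology ::
    "(nat \<Rightarrow> 'a::real_normed_field) set \<Rightarrow> (nat \<Rightarrow> (nat \<Rightarrow> 'a) \<Rightarrow> real) \<Rightarrow> (nat \<Rightarrow> 'a) topology" where
  "seminorm_topology E p =
    topology_generated_by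
      {{y \<in> E. p k (\<lambda>n. y n - x n) < \<epsilon>} | x k \<epsilon>. x \<in> E \<and> k \<ge> 1 \<and> \<epsilon> > 0}"

lemma topspace_seminorm_topology:
  assumes "\<And>k. p k (\<lambda>n. 0) = 0"
  shows "topspace (seminorm_topology E p) = E"
proof -
  have "x \<in> \<Union> {{y \<in> E. p k (\<lambda>n. y n - x n) < \<epsilon>} | x k \<epsilon>. x \<in> E \<and> k \<ge> 1 \<and> \<epsilon> > 0}"
    if "x \<in> E" for x
  proof (rule UnionI)
    show "{y \<in> E. p 1 (\<lambda>n. y n - x n) < 1}
        \<in> {{y \<in> E. p k (\<lambda>n. y n - x n) < \<epsilon>} | x k \<epsilon>. x \<in> E \<and> k \<ge> 1 \<and> \<epsilon> > 0}"
      using that zero_less_one by blast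
    show "x \<in> {y \<in> E. p 1 (\<lambda>n. y n - x n) < 1}"
      using that assms by simp
  qed
  then show ?thesis
    unfolding seminorm_topology_def topology_generated_by_topspace by blast
qed

definition Lambda_1 :: "(nat \<Rightarrow> real) \<Rightarrow> (nat \<Rightarrow> 'a::real_normed_field) topology" where
  "Lambda_1 \<alpha> = seminorm_topology (fin_power_series_space \<alpha>) (fin_seminorm \<alpha>)"

definition Lambda_inf :: "(nat \<Rightarrow> real) \<Rightarrow> (nat \<Rightarrow> 'a::real_normed_field) topology" where
  "Lambda_inf \<alpha> = seminorm_topology (inf_power_series_space \<alpha>) (inf_seminorm \<alpha>)"

lemma topspace_Lambda_1 [simp]: "topspace (Lambda_1 \<alpha>) = fin_power_series_space \<alpha>"
  unfolding Lambda_1_def by (rule topspace_seminorm_topology) (simp add: fin_seminorm_def)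

lemma topspace_Lambda_inf [simp]: "topspace (Lambda_inf \<alpha>) = inf_power_series_space \<alpha>"
  unfolding Lambda_inf_def by (rule topspace_seminorm_topology) (simp add: inf_seminorm_def)

definition zero_neighbourhood :: "(nat \<Rightarrow> 'a::real_normed_field) topology \<Rightarrow> (nat \<Rightarrow> 'a) set \<Rightarrow> bool" where
  "zero_neighbourhood X U \<longleftrightarrow>
    U \<subseteq> topspace X \<and> (\<exists>W. openin X W \<and> (\<lambda>n. 0) \<in> W \<and> W \<subseteq> U)"

text \<open>Precompactness is total boundedness with respect to the linear uniform structure.\<close>

definition precompact_in :: "(nat \<Rightarrow> 'a::real_normed_field) topology \<Rightarrow> (nat \<Rightarrow> 'a) set \<Rightarrow> bool" where
  "precompact_in Y M \<longleftrightarrow> M \<subseteq> topspace Y \<and>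
    (\<forall>V. zero_neighbourhood Y V \<longrightarrow>
      (\<exists>S. finite S \<and> S \<subseteq> topspace Y \<and> M \<subseteq> {\<lambda>n. s n + v n | s v. s \<in> S \<and> v \<in> V}))"

definition linear_map_between ::
    "(nat \<Rightarrow> 'a::real_normed_field) topology \<Rightarrow> (nat \<Rightarrow> 'a) topology \<Rightarrow>
      ((nat \<Rightarrow> 'a) \<Rightarrow> (nat \<Rightarrow> 'a)) \<Rightarrow> bool" where
  "linear_map_between X Y T \<longleftrightarrow>
    (\<forall>x\<in>topspace X. T x \<in> topspace Y) \<and>
    (\<forall>x\<in>topspace X. \<forall>y\<in>topspace X. T (\<lambda>n. x n + y n) = (\<lambda>n. T x n + T y n)) \<and>
    (\<forall>c. \<forall>x\<in>topspace X. T (\<lambda>n. c * x n) = (\<lambda>n. c * T x n))"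

definition compact_linear_map ::
    "(nat \<Rightarrow> 'a::real_normed_field) topology \<Rightarrow> (nat \<Rightarrow> 'a) topology \<Rightarrow>
      ((nat \<Rightarrow> 'a) \<Rightarrow> (nat \<Rightarrow> 'a)) \<Rightarrow> bool" where
  "compact_linear_map X Y T \<longleftrightarrow>
    linear_map_between X Y T \<and> (\<exists>U. zero_neighbourhood X U \<and> precompact_in Y (T ` U))"

text \<open>
  \<open>hankel_column \<theta> n\<close> is the image of the unit sequence with \<open>1\<close> at position \<open>n\<close>. After the
  shift of both positions by one, the entry \<open>\<theta>\<^bsub>j+n-2\<^esub>\<close> becomes \<open>\<theta>\<^bsub>j+n\<^esub>\<close>.
\<close>

definition hankel_column :: "(nat \<Rightarrow> 'a::real_normed_field) \<Rightarrow> nat \<Rightarrow> nat \<Rightarrow> 'a" where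
  "hankel_column \<theta> n = (\<lambda>j. \<theta> (j + n))"

definition hankel_partial_sum ::
    "(nat \<Rightarrow> 'a::real_normed_field) \<Rightarrow> (nat \<Rightarrow> 'a) \<Rightarrow> nat \<Rightarrow> nat \<Rightarrow> 'a" where
  "hankel_partial_sum \<theta> x N = (\<lambda>j. \<Sum>n<N. x n * hankel_column \<theta> n j)"

definition hankel_well_defined ::
    "(nat \<Rightarrow> 'a::real_normed_field) topology \<Rightarrow> (nat \<Rightarrow> 'a) topology \<Rightarrow> (nat \<Rightarrow> 'a) \<Rightarrow> bool" where
  "hankel_well_defined X Y \<theta> \<longleftrightarrow>
    (\<forall>n. hankel_column \<theta> n \<in> topspace Y) \<and>
    (\<forall>x\<in>topspace X. \<exists>y. limitin Y (hankel_partial_sum \<theta> x) y sequentially)"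

text \<open>The sum of the series is taken in the topology of the target space \<open>Y\<close>.\<close>

definition hankel_operator ::
    "(nat \<Rightarrow> 'a::real_normed_field) topology \<Rightarrow> (nat \<Rightarrow> 'a) \<Rightarrow> (nat \<Rightarrow> 'a) \<Rightarrow> (nat \<Rightarrow> 'a)" where
  "hankel_operator Y \<theta> x = (THE y. limitin Y (hankel_partial_sum \<theta> x) y sequentially)"

end

theory Submission
  imports Defs
begin

text \<open>
  Both power series spaces are Koethe echelon spaces. Since \<open>\<beta>\<close> increases and \<open>\<alpha> \<le> A \<beta> + B\<close>,
  the columns satisfy
  \<open>\<parallel>H e\<^sub>n\<parallel>\<^sub>k \<le> \<parallel>\<theta>\<parallel>\<^bsub>k+A\<^esub> exp (- A \<beta>\<^sub>n) \<le> C\<^sub>k exp (- \<alpha>\<^sub>n)\<close>, hence \<open>\<parallel>H x\<parallel>\<^sub>k \<le> C\<^sub>k \<parallel>x\<parallel>\<^sub>1\<close> for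
  every \<open>k\<close>. The unit ball of the single seminorm \<open>\<parallel>\<cdot>\<parallel>\<^sub>1\<close> is thus mapped to a bounded set, and
  bounded subsets of \<open>\<Lambda>\<^sub>\<infinity>(\<beta>)\<close> are precompact because \<open>\<beta>\<close> tends to infinity.
\<close>

section \<open>Absolute convergence over complete scalar fields\<close>

text \<open>The sort \<open>{real_normed_field, heine_borel}\<close> is not a subsort of \<open>banach\<close>, so the
  library's criterion for absolute convergence does not apply to it.\<close>

lemma summable_norm_cancel_complete:
  fixes f :: "nat \<Rightarrow> 'a::{real_normed_vector, complete_space}"
  assumes "summable (\<lambda>n. norm (f n))"
  shows "summable f"
proof -
  let ?G = "\<lambda>n. \<Sum>i<n. norm (f i)"
  have G: "Cauchy ?G"
    using assms by (simp add: summable_iff_convergent convergent_Cauchy)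
  have "Cauchy (\<lambda>n. \<Sum>i<n. f i)"
  proof (rule CauchyI')
    fix e :: real assume "e > 0"
    then obtain M where M: "norm (?G m - ?G n) < e" if "m \<ge> M" "n \<ge> M" for m n
      using CauchyD[OF G] by blast
    \<comment> \<open>The block from \<open>m\<close> to \<open>n\<close> has norm at most the
      corresponding block of the norm series, which is an increment of the Cauchy sequence
      \<open>?G\<close>.\<close>
    have "dist (\<Sum>i<m. f i) (\<Sum>i<n. f i) < e" if "m \<ge> M" "m < n" for m n
    proof -
      have "(\<Sum>i<n. f i) = (\<Sum>i<m. f i) + (\<Sum>i=m..<n. f i)"
        using that by (metis lessThan_atLeast0 less_imp_le_nat sum.atLeastLessThan_concat zero_le)
      moreover have "?G n = ?G m + (\<Sum>i=m..<n. norm (f i))"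
        using that by (metis lessThan_atLeast0 less_imp_le_nat sum.atLeastLessThan_concat zero_le)
      moreover have "norm (\<Sum>i=m..<n. f i) \<le> (\<Sum>i=m..<n. norm (f i))"
        by (rule norm_sum)
      ultimately show ?thesis
        using M[of m n] that by (simp add: dist_norm sum_nonneg)
    qed
    then show "\<exists>M. \<forall>m\<ge>M. \<forall>n>m. dist (\<Sum>i<m. f i) (\<Sum>i<n. f i) < e"
      by blast
  qed
  then show ?thesis
    by (simp add: summable_iff_convergent Cauchy_convergent)
qed

section \<open>Koethe echelon spaces and their topology\<close>

text \<open>A general weight \<open>w k n\<close> lets one theory serve the finite type, with weight
  \<open>exp (- (1 / real k) * \<alpha> n)\<close>, and the infinite type, with weight
  \<open>exp (real k * \<beta> n)\<close>.\<close>

definition koethe_space :: "(nat \<Rightarrow> nat \<Rightarrow> real) \<Rightarrow> (nat \<Rightarrow> 'a::real_normed_field) set" where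
  "koethe_space w = {x. \<forall>k\<ge>1. summable (\<lambda>n. norm (x n) * w k n)}"

definition koethe_seminorm ::
    "(nat \<Rightarrow> nat \<Rightarrow> real) \<Rightarrow> nat \<Rightarrow> (nat \<Rightarrow> 'a::real_normed_field) \<Rightarrow> real" where
  "koethe_seminorm w k x = (\<Sum>n. norm (x n) * w k n)"

definition koethe_topology :: "(nat \<Rightarrow> nat \<Rightarrow> real) \<Rightarrow> (nat \<Rightarrow> 'a::real_normed_field) topology" where
  "koethe_topology w = seminorm_topology (koethe_space w) (koethe_seminorm w)"

lemma topspace_koethe_topology [simp]: "topspace (koethe_topology w) = koethe_space w"
  unfolding koethe_topology_def
  by (rule topspace_seminorm_topology) (simp add: koethe_seminorm_def)

text \<open>Monotonicity starts at \<open>k = 1\<close>: for the finite type,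
  \<open>1 / real 0 = 0\<close> makes the weight of index 0 equal to 1, which dominates all the
  others.\<close>

locale koethe_matrix =
  fixes w :: "nat \<Rightarrow> nat \<Rightarrow> real"
  assumes weight_pos: "0 < w k n"
    and weight_mono: "1 \<le> k \<Longrightarrow> k \<le> l \<Longrightarrow> w k n \<le> w l n"
begin

lemma summable_koethe: "x \<in> koethe_space w \<Longrightarrow> 1 \<le> k \<Longrightarrow> summable (\<lambda>n. norm (x n) * w k n)"
  by (simp add: koethe_space_def)

lemma term_nonneg [simp]: "0 \<le> norm a * w k n"
  using weight_pos[of k n] by simp

lemma koethe_space_add:
  assumes "x \<in> koethe_space w" "y \<in> koethe_space w"
  shows "(\<lambda>n. x n + y n) \<in> koethe_space w"
proof -
  have "summable (\<lambda>n. norm (x n + y n) * w k n)" if "1 \<le> k" for k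
  proof (rule summable_comparison_test'[of _ 0])
    show "summable (\<lambda>n. norm (x n) * w k n + norm (y n) * w k n)"
      using assms that by (intro summable_add summable_koethe)
    show "norm (norm (x n + y n) * w k n) \<le> norm (x n) * w k n + norm (y n) * w k n" for n
      using weight_pos[of k n] norm_triangle_ineq[of "x n" "y n"]
      by (simp add: abs_mult flip: distrib_right)
  qed
  then show ?thesis by (simp add: koethe_space_def)
qed

lemma koethe_space_scale:
  assumes "x \<in> koethe_space w"
  shows "(\<lambda>n. c * x n) \<in> koethe_space w"
  using assms by (auto simp: koethe_space_def norm_mult mult.assoc intro: summable_mult)

lemma koethe_space_diff:
  assumes "x \<in> koethe_space w" "y \<in> koethe_space w"
  shows "(\<lambda>n. x n - y n) \<in> koethe_space w"
  using koethe_space_add[OF assms(1) koethe_space_scale[OF assms(2), of "-1"]] by simp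

text \<open>Supplies the zero sequence, the truncations of a sequence and the points of the finite
  nets used for precompactness.\<close>

lemma koethe_space_finite_support: "(\<lambda>n. if n < N then x n else 0) \<in> koethe_space w"
  unfolding koethe_space_def by (intro CollectI allI impI summable_finite[of "{..<N}"]) auto

lemma koethe_seminorm_triangle:
  assumes "x \<in> koethe_space w" "y \<in> koethe_space w" "1 \<le> k"
  shows "koethe_seminorm w k (\<lambda>n. x n + y n) \<le> koethe_seminorm w k x + koethe_seminorm w k y"
proof -
  have "norm (x n + y n) * w k n \<le> norm (x n) * w k n + norm (y n) * w k n" for n
    using weight_pos[of k n] norm_triangle_ineq[of "x n" "y n"] by (simp flip: distrib_right)
  then show ?thesis
    unfolding koethe_seminorm_def
    using assms koethe_space_add[OF assms(1,2)]
    by (subst suminf_add) (auto intro!: suminf_le summable_add summable_koethe)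
qed

lemma koethe_seminorm_mono:
  assumes "x \<in> koethe_space w" "1 \<le> k" "k \<le> l"
  shows "koethe_seminorm w k x \<le> koethe_seminorm w l x"
  unfolding koethe_seminorm_def
  using assms by (intro suminf_le summable_koethe mult_left_mono weight_mono) auto

text \<open>A single summand is at most the sum of a nonnegative series. Hence convergence in the
  space is coordinatewise, and the coordinates of a bounded set stay in fixed discs.\<close>

lemma term_le_koethe_seminorm:
  assumes "x \<in> koethe_space w" "1 \<le> k"
  shows "norm (x n) * w k n \<le> koethe_seminorm w k x"
  using sum_le_suminf[OF summable_koethe[OF assms], of "{n}"] by (simp add: koethe_seminorm_def)

lemma openin_koethe_ball:
  assumes "x \<in> koethe_space w" "1 \<le> k" "0 < \<epsilon>"
  shows "openin (koethe_topology w) {y \<in> koethe_space w. koethe_seminorm w k (\<lambda>n. y n - x n) < \<epsilon>}"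
  unfolding koethe_topology_def seminorm_topology_def
  by (rule topology_generated_by_Basis) (use assms in blast)

text \<open>The balls are given only as a subbasis. They form a basis because increasing weights
  make the seminorms directed; the proof is by induction on the generation of the open set.\<close>

lemma openin_koethe_contains_ball:
  fixes x :: "nat \<Rightarrow> 'a::real_normed_field"
  assumes "openin (koethe_topology w) W" "x \<in> W"
  obtains k \<epsilon> where "1 \<le> k" "0 < \<epsilon>"
    "{y \<in> koethe_space w. koethe_seminorm w k (\<lambda>n. y n - x n) < \<epsilon>} \<subseteq> W"
proof -
  define B where "B = (\<lambda>(x :: nat \<Rightarrow> 'a) k \<epsilon>. {y \<in> koethe_space w. koethe_seminorm w k (\<lambda>n. y n - x n) < \<epsilon>})"
  have gen: "generate_topology_on {B x k \<epsilon> | x k \<epsilon>. x \<in> koethe_space w \<and> k \<ge> 1 \<and> \<epsilon> > 0}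
      = openin (koethe_topology w)"
    by (simp add: fun_eq_iff koethe_topology_def seminorm_topology_def openin_topology_generated_by_iff B_def)
  have "\<forall>x\<in>W. \<exists>k\<ge>1. \<exists>\<epsilon>>0. B x k \<epsilon> \<subseteq> W"
    using assms(1)[folded gen]
  proof induction
    case Empty
    then show ?case by simp
  next
    case (Int V W)
    show ?case
    proof
      fix x :: "nat \<Rightarrow> 'a" assume x: "x \<in> V \<inter> W"
      obtain k \<epsilon> where k: "k \<ge> 1" "\<epsilon> > 0" "B x k \<epsilon> \<subseteq> V"
        using Int x by blast
      obtain l \<delta> where l: "l \<ge> 1" "\<delta> > 0" "B x l \<delta> \<subseteq> W"
        using Int x by blast
      have "x \<in> koethe_space w"
        using Int.hyps(1)[unfolded gen] x openin_subset by fastforce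
      \<comment> \<open>The seminorms grow with the index, so the larger index together with the
        smaller radius serves both balls.\<close>
      then have "B x (max k l) (min \<epsilon> \<delta>) \<subseteq> B x k \<epsilon> \<inter> B x l \<delta>"
        unfolding B_def
        using koethe_seminorm_mono[OF koethe_space_diff, of _ x k "max k l"]
          koethe_seminorm_mono[OF koethe_space_diff, of _ x l "max k l"] k(1) l(1)
        by fastforce
      then show "\<exists>k\<ge>1. \<exists>\<epsilon>>0. B x k \<epsilon> \<subseteq> V \<inter> W"
        using k l by (intro exI[of _ "max k l"] conjI exI[of _ "min \<epsilon> \<delta>"]) auto
    qed
  next
    case (UN K)
    then show ?case by (meson Union_iff Sup_upper subset_trans)
  next
    case (Basis U)
    then obtain z k \<epsilon> where U: "U = B z k \<epsilon>" "z \<in> koethe_space w" "k \<ge> 1" "\<epsilon> > 0"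
      by blast
    show ?case
    proof
      fix x :: "nat \<Rightarrow> 'a" assume x: "x \<in> U"
      \<comment> \<open>A generating ball need not be centred at \<open>x\<close>; the distance from
        \<open>x\<close> to its centre \<open>z\<close> is subtracted from the radius.\<close>
      define \<delta> where "\<delta> = \<epsilon> - koethe_seminorm w k (\<lambda>n. x n - z n)"
      have xE: "x \<in> koethe_space w" and "\<delta> > 0"
        using x by (simp_all add: U B_def \<delta>_def)
      have "y \<in> U" if y: "y \<in> B x k \<delta>" for y
      proof -
        have yE: "y \<in> koethe_space w"
          using y by (simp add: B_def)
        have "koethe_seminorm w k (\<lambda>n. (y n - x n) + (x n - z n))
            \<le> koethe_seminorm w k (\<lambda>n. y n - x n) + koethe_seminorm w k (\<lambda>n. x n - z n)"
          using xE yE U by (intro koethe_seminorm_triangle koethe_space_diff)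
        then show ?thesis
          using y yE by (simp add: U B_def \<delta>_def)
      qed
      then show "\<exists>k\<ge>1. \<exists>\<epsilon>>0. B x k \<epsilon> \<subseteq> U"
        using U(3) \<open>\<delta> > 0\<close> by blast
    qed
  qed
  then show ?thesis
    using assms(2) that unfolding B_def by blast
qed

lemma zero_neighbourhood_koethe_ball:
  assumes "1 \<le> k" "0 < \<epsilon>"
  shows "zero_neighbourhood (koethe_topology w)
    {y :: nat \<Rightarrow> 'a::real_normed_field. y \<in> koethe_space w \<and> koethe_seminorm w k y < \<epsilon>}"
proof -
  let ?B = "{y :: nat \<Rightarrow> 'a. y \<in> koethe_space w \<and> koethe_seminorm w k y < \<epsilon>}"
  have "(\<lambda>n. 0 :: 'a) \<in> koethe_space w"
    using koethe_space_finite_support[of 0] by simp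
  then have "openin (koethe_topology w) ?B" "(\<lambda>n. 0) \<in> ?B"
    using openin_koethe_ball[of "\<lambda>n. 0 :: 'a" k \<epsilon>] assms by (simp_all add: koethe_seminorm_def)
  then show ?thesis
    unfolding zero_neighbourhood_def by auto
qed

text \<open>In each seminorm the error is the tail of a convergent series. This is the expansion of
  \<open>x\<close> along the unit sequences, to which the continuous operator is applied
  later.\<close>

lemma limitin_koethe_truncation:
  assumes x: "x \<in> koethe_space w"
  shows "limitin (koethe_topology w) (\<lambda>N n. if n < N then x n else 0) x sequentially"
  unfolding limitin_def
proof (intro conjI allI impI)
  show "x \<in> topspace (koethe_topology w)"
    using x by simp
  fix W assume "openin (koethe_topology w) W \<and> x \<in> W"
  then obtain k \<epsilon> where k: "1 \<le> k" "0 < \<epsilon>"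
      and W: "{y \<in> koethe_space w. koethe_seminorm w k (\<lambda>n. y n - x n) < \<epsilon>} \<subseteq> W"
    using openin_koethe_contains_ball by blast
  let ?f = "\<lambda>n. norm (x n) * w k n"
  have "(\<lambda>N. (\<Sum>n<N. ?f n)) \<longlonglongrightarrow> suminf ?f"
    by (rule summable_LIMSEQ[OF summable_koethe[OF x k(1)]])
  then have "\<forall>\<^sub>F N in sequentially. suminf ?f - \<epsilon> < (\<Sum>n<N. ?f n)"
    using k(2) by (intro order_tendstoD) auto
  then show "\<forall>\<^sub>F N in sequentially. (\<lambda>n. if n < N then x n else 0) \<in> W"
  proof eventually_elim
    case (elim N)
    \<comment> \<open>The error vanishes below \<open>N\<close> and is \<open>- x n\<close> from
      there on, so its seminorm is the full series minus the partial sum.\<close>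
    have "(\<lambda>n. norm ((if n < N then x n else 0) - x n) * w k n)
        = (\<lambda>n. ?f n - (if n \<in> {..<N} then ?f n else 0))"
      by auto
    moreover have "(\<lambda>n. if n \<in> {..<N} then ?f n else 0) sums (\<Sum>n<N. ?f n)"
      by (rule sums_If_finite_set) simp
    ultimately have "(\<lambda>n. norm ((if n < N then x n else 0) - x n) * w k n)
        sums (suminf ?f - (\<Sum>n<N. ?f n))"
      by (simp only: sums_diff[OF summable_sums[OF summable_koethe[OF x k(1)]]])
    then have "koethe_seminorm w k (\<lambda>n. (if n < N then x n else 0) - x n) < \<epsilon>"
      using elim by (simp add: koethe_seminorm_def sums_unique[symmetric])
    then show ?case
      using W koethe_space_finite_support by blast
  qed
qed

text \<open>Coordinates are continuous, so a limit is determined by scalar limits. This justifies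
  the definite description in \<open>hankel_operator\<close>.\<close>

lemma limitin_koethe_unique:
  fixes f :: "nat \<Rightarrow> nat \<Rightarrow> 'a::real_normed_field"
  assumes "limitin (koethe_topology w) f y sequentially"
    and "limitin (koethe_topology w) f z sequentially"
  shows "y = z"
proof
  fix n
  have "(\<lambda>N. f N n) \<longlonglongrightarrow> l n" if l: "limitin (koethe_topology w) f l sequentially" for l
  proof (rule tendstoI)
    fix e :: real assume e: "e > 0"
    have lE: "l \<in> koethe_space w"
      using l by (simp add: limitin_def)
    \<comment> \<open>The factor \<open>w 1 n\<close> in the radius cancels against the weight of
      the \<open>n\<close>-th coordinate, leaving \<open>e\<close>.\<close>
    let ?B = "{y \<in> koethe_space w. koethe_seminorm w 1 (\<lambda>n. y n - l n) < e * w 1 n}"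
    have "openin (koethe_topology w) ?B"
      using lE e weight_pos by (intro openin_koethe_ball) auto
    moreover have "l \<in> ?B"
      using lE e weight_pos by (simp add: koethe_seminorm_def)
    ultimately have "\<forall>\<^sub>F N in sequentially. f N \<in> ?B"
      using l unfolding limitin_def by blast
    then show "\<forall>\<^sub>F N in sequentially. dist (f N n) (l n) < e"
    proof eventually_elim
      case (elim N)
      then have "norm (f N n - l n) * w 1 n < e * w 1 n"
        using term_le_koethe_seminorm[OF koethe_space_diff[of "f N" l], of 1 n] lE by force
      then show ?case
        using weight_pos[of 1 n] by (simp add: dist_norm)
    qed
  qed
  then show "y n = z n"
    using assms LIMSEQ_unique by blast
qed

section \<open>Precompactness of bounded sets\<close>

text \<open>Vanishing weight quotients make the tails in the \<open>k\<close>-th seminorm uniformly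
  small against the bounded \<open>l\<close>-th seminorm. The finitely many remaining coordinates
  lie in discs, which are totally bounded by the Heine-Borel property of the scalars.\<close>

lemma precompact_in_koethe_if_bounded:
  fixes M :: "(nat \<Rightarrow> 'a::{real_normed_field, heine_borel}) set"
  assumes M: "M \<subseteq> koethe_space w"
    and bounded: "\<And>k. 1 \<le> k \<Longrightarrow> \<exists>C. \<forall>y\<in>M. koethe_seminorm w k y \<le> C"
    and small: "\<And>k. 1 \<le> k \<Longrightarrow> \<exists>l\<ge>1. (\<lambda>n. w k n / w l n) \<longlonglongrightarrow> 0"
  shows "precompact_in (koethe_topology w) M"
  unfolding precompact_in_def
proof (intro conjI allI impI)
  show "M \<subseteq> topspace (koethe_topology w)"
    using M by simp
  fix V :: "(nat \<Rightarrow> 'a) set" assume "zero_neighbourhood (koethe_topology w) V"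
  then obtain W where W: "openin (koethe_topology w) W" "(\<lambda>n. 0) \<in> W" "W \<subseteq> V"
    unfolding zero_neighbourhood_def by blast
  obtain k \<epsilon> where k: "1 \<le> k" "0 < \<epsilon>"
      and "{y \<in> koethe_space w. koethe_seminorm w k (\<lambda>n. y n - 0) < \<epsilon>} \<subseteq> W"
    by (rule openin_koethe_contains_ball[OF W(1,2)])
  then have ball_V: "y \<in> V" if "y \<in> koethe_space w" "koethe_seminorm w k y < \<epsilon>" for y
    using that W(3) by auto
  obtain l where l: "1 \<le> l" "(\<lambda>n. w k n / w l n) \<longlonglongrightarrow> 0"
    using small[OF k(1)] by blast
  obtain C0 where C0: "\<forall>y\<in>M. koethe_seminorm w l y \<le> C0"
    using bounded[OF l(1)] by blast
  \<comment> \<open>The maximum with 1 keeps \<open>C\<close> positive, since it is divided by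
    below.\<close>
  define C where "C = max C0 1"
  have C: "koethe_seminorm w l y \<le> C" if "y \<in> M" for y
    using C0 that unfolding C_def by (simp add: le_max_iff_disj)
  have "C > 0"
    by (simp add: C_def)
  \<comment> \<open>Chosen so that the tail contributes at most
    \<open>\<delta> * C = \<epsilon> / 4\<close>.\<close>
  define \<delta> where "\<delta> = \<epsilon> / (4 * C)"
  have "\<delta> > 0"
    using k \<open>C > 0\<close> by (simp add: \<delta>_def)
  then have "\<forall>\<^sub>F n in sequentially. w k n / w l n < \<delta>"
    using l(2) by (intro order_tendstoD)
  then obtain N where N': "\<And>n. n \<ge> N \<Longrightarrow> w k n / w l n < \<delta>"
    by (auto simp: eventually_sequentially)
  then have N: "w k n \<le> \<delta> * w l n" if "n \<ge> N" for n
    using N'[OF that] weight_pos[of l n] by (simp add: divide_less_eq)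
  \<comment> \<open>The summand 1 keeps \<open>D\<close> positive even when \<open>N = 0\<close>.
    With \<open>\<eta>\<close> below, the first \<open>N\<close> coordinates contribute at most
    \<open>\<eta> * D = \<epsilon> / 4\<close>.\<close>
  define D where "D = (\<Sum>n<N. w k n) + 1"
  have "D > 0"
    unfolding D_def by (smt (verit) sum_nonneg weight_pos)
  define \<eta> where "\<eta> = \<epsilon> / (4 * D)"
  have "\<eta> > 0"
    using k \<open>D > 0\<close> by (simp add: \<eta>_def)
  have "\<exists>S. finite S \<and> cball (0::'a) (C / w l n) \<subseteq> (\<Union>s\<in>S. ball s \<eta>)" for n
    using compact_cball[of "0::'a" "C / w l n"] \<open>\<eta> > 0\<close>
    unfolding compact_eq_totally_bounded by blast
  then obtain S where S: "finite (S n)" "cball (0::'a) (C / w l n) \<subseteq> (\<Union>s\<in>S n. ball s \<eta>)" for n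
    by metis
  \<comment> \<open>One net point per coordinate below \<open>N\<close>, continued by zero. The
    extensional product makes the set of choices finite.\<close>
  define F where "F = (\<lambda>s n. if n < N then s n else 0) ` (\<Pi>\<^sub>E n\<in>{..<N}. S n)"
  have "finite F"
    unfolding F_def by (intro finite_imageI finite_PiE S) simp
  moreover have F_sub: "F \<subseteq> koethe_space w"
    unfolding F_def using koethe_space_finite_support by blast
  moreover have "y \<in> {\<lambda>n. s n + v n | s v. s \<in> F \<and> v \<in> V}" if y: "y \<in> M" for y
  proof -
    have yE: "y \<in> koethe_space w"
      using y M by blast
    have "\<exists>s\<in>S n. dist s (y n) < \<eta>" for n
    proof -
      have "norm (y n) * w l n \<le> C"
        using term_le_koethe_seminorm[OF yE l(1), of n] C[OF y] by simp
      then have "y n \<in> cball 0 (C / w l n)"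
        using weight_pos[of l n] by (simp add: field_simps)
      then have "y n \<in> (\<Union>s\<in>S n. ball s \<eta>)"
        using S(2)[of n] by blast
      then show ?thesis
        by auto
    qed
    then obtain s where s: "s n \<in> S n" "dist (s n) (y n) < \<eta>" for n
      by metis
    define t where "t = (\<lambda>n. if n < N then s n else 0)"
    \<comment> \<open>The chosen \<open>s\<close> is defined at every \<open>n\<close>; only its
      restriction belongs to the extensional product.\<close>
    have "t = (\<lambda>n. if n < N then restrict s {..<N} n else 0)"
      by (auto simp: t_def)
    moreover have "restrict s {..<N} \<in> (\<Pi>\<^sub>E n\<in>{..<N}. S n)"
      using s(1) by auto
    ultimately have tF: "t \<in> F"
      unfolding F_def by blast
    define v where "v = (\<lambda>n. y n - t n)"
    have vE: "v \<in> koethe_space w"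
      unfolding v_def using yE tF F_sub by (intro koethe_space_diff) auto
    let ?h = "\<lambda>n. if n \<in> {..<N} then \<eta> * w k n else 0"
    have h: "?h sums (\<Sum>n<N. \<eta> * w k n)"
      by (rule sums_If_finite_set) simp
    have g: "(\<lambda>n. \<delta> * (norm (y n) * w l n)) sums (\<delta> * koethe_seminorm w l y)"
      unfolding koethe_seminorm_def
      by (intro sums_mult summable_sums summable_koethe yE l)
    \<comment> \<open>Below \<open>N\<close> the net bounds the entry by \<open>\<eta>\<close> and
      the second summand is mere slack; from \<open>N\<close> on, \<open>t\<close> vanishes, so
      \<open>v\<close> agrees with \<open>y\<close> and the weight quotient gives
      \<open>\<delta>\<close>.\<close>
    have "koethe_seminorm w k v \<le> (\<Sum>n<N. \<eta> * w k n) + \<delta> * koethe_seminorm w l y"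
      unfolding koethe_seminorm_def[of w k]
    proof (rule sums_le[OF _ summable_sums[OF summable_koethe[OF vE k(1)]] sums_add[OF h g]])
      fix n
      show "norm (v n) * w k n \<le> ?h n + \<delta> * (norm (y n) * w l n)"
      proof (cases "n < N")
        case True
        then have "norm (v n) \<le> \<eta>"
          using s(2)[of n] by (simp add: v_def t_def dist_norm norm_minus_commute)
        then have "norm (v n) * w k n \<le> \<eta> * w k n"
          using weight_pos[of k n] by (simp add: mult_right_mono)
        moreover have "0 \<le> \<delta> * (norm (y n) * w l n)"
          using \<open>\<delta> > 0\<close> by simp
        ultimately show ?thesis
          using True by simp
      next
        case False
        then have "norm (y n) * w k n \<le> norm (y n) * (\<delta> * w l n)"
          using N by (intro mult_left_mono) auto
        then show ?thesis
          using False by (simp add: v_def t_def mult_ac)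
      qed
    qed
    also have "(\<Sum>n<N. \<eta> * w k n) \<le> \<eta> * D"
      unfolding D_def using \<open>\<eta> > 0\<close> by (simp add: distrib_left flip: sum_distrib_left)
    also have "\<eta> * D = \<epsilon> / 4"
      using \<open>D > 0\<close> by (simp add: \<eta>_def)
    also have "\<delta> * koethe_seminorm w l y \<le> \<delta> * C"
      using C[OF y] \<open>\<delta> > 0\<close> by simp
    also have "\<delta> * C = \<epsilon> / 4"
      using \<open>C > 0\<close> by (simp add: \<delta>_def)
    finally have "v \<in> V"
      using k(2) by (intro ball_V vE) simp
    moreover have "y = (\<lambda>n. t n + v n)"
      by (simp add: v_def)
    ultimately show ?thesis
      using tF by blast
  qed
  ultimately show "\<exists>S. finite S \<and> S \<subseteq> topspace (koethe_topology w)
      \<and> M \<subseteq> {\<lambda>n. s n + v n | s v. s \<in> S \<and> v \<in> V}"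
    by (intro exI[of _ F]) auto
qed

end

section \<open>Power series spaces as Koethe spaces\<close>

lemma koethe_matrix_fin:
  assumes "\<And>n. 0 \<le> \<alpha> n"
  shows "koethe_matrix (\<lambda>k n. exp (- (1 / real k) * \<alpha> n))"
proof
  fix k l n :: nat assume "1 \<le> k" "k \<le> l"
  then have "1 / real l \<le> 1 / real k"
    by (intro divide_left_mono) auto
  then show "exp (- (1 / real k) * \<alpha> n) \<le> exp (- (1 / real l) * \<alpha> n)"
    using mult_right_mono[OF _ assms[of n]] by fastforce
qed simp

lemma koethe_matrix_inf:
  assumes "\<And>n. 0 \<le> \<beta> n"
  shows "koethe_matrix (\<lambda>k n. exp (real k * \<beta> n))"
  by standard (use assms in \<open>auto intro!: mult_right_mono\<close>)

lemma fin_power_series_space_koethe: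
  "fin_power_series_space \<alpha> = koethe_space (\<lambda>k n. exp (- (1 / real k) * \<alpha> n))"
  by (simp add: fin_power_series_space_def koethe_space_def)

lemma inf_power_series_space_koethe:
  "inf_power_series_space \<beta> = koethe_space (\<lambda>k n. exp (real k * \<beta> n))"
  by (simp add: inf_power_series_space_def koethe_space_def)

lemma Lambda_1_koethe: "Lambda_1 \<alpha> = koethe_topology (\<lambda>k n. exp (- (1 / real k) * \<alpha> n))"
  unfolding Lambda_1_def koethe_topology_def fin_power_series_space_koethe
  by (intro arg_cong2[where f = seminorm_topology] ext)
    (simp_all add: fin_seminorm_def koethe_seminorm_def)

lemma Lambda_inf_koethe: "Lambda_inf \<beta> = koethe_topology (\<lambda>k n. exp (real k * \<beta> n))"
  unfolding Lambda_inf_def koethe_topology_def inf_power_series_space_koethe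
  by (intro arg_cong2[where f = seminorm_topology] ext)
    (simp_all add: inf_seminorm_def koethe_seminorm_def)

section \<open>Continuity from seminorm estimates\<close>

text \<open>Compatibility with differences moves the estimate to every point: the
  \<open>l\<close>-ball of radius \<open>\<epsilon> / C\<close> around \<open>x\<close> goes into
  the \<open>k\<close>-ball of radius \<open>\<epsilon>\<close> around \<open>T x\<close>.\<close>

lemma continuous_map_koethe:
  fixes T :: "(nat \<Rightarrow> 'a::real_normed_field) \<Rightarrow> nat \<Rightarrow> 'a"
  assumes "koethe_matrix u" "koethe_matrix w"
    and maps: "\<And>x. x \<in> koethe_space u \<Longrightarrow> T x \<in> koethe_space w"
    and diff: "\<And>x y. x \<in> koethe_space u \<Longrightarrow> y \<in> koethe_space u
      \<Longrightarrow> T (\<lambda>n. x n - y n) = (\<lambda>n. T x n - T y n)"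
    and bound: "\<And>k. 1 \<le> k \<Longrightarrow> \<exists>l\<ge>1. \<exists>C>0. \<forall>x\<in>koethe_space u.
      koethe_seminorm w k (T x) \<le> C * koethe_seminorm u l x"
  shows "continuous_map (koethe_topology u) (koethe_topology w) T"
proof -
  interpret u: koethe_matrix u by fact
  interpret w: koethe_matrix w by fact
  have "openin (koethe_topology u) {x \<in> koethe_space u. T x \<in> V}"
    if V: "openin (koethe_topology w) V" for V
  proof (subst openin_subopen, intro ballI)
    fix x assume "x \<in> {x \<in> koethe_space u. T x \<in> V}"
    then have x: "x \<in> koethe_space u" "T x \<in> V"
      by auto
    obtain k \<epsilon> where k: "1 \<le> k" "0 < \<epsilon>"
        and ball_V: "{y \<in> koethe_space w. koethe_seminorm w k (\<lambda>n. y n - T x n) < \<epsilon>} \<subseteq> V"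
      by (rule w.openin_koethe_contains_ball[OF V x(2)])
    obtain l C where l: "1 \<le> l" "0 < C"
        and C: "\<forall>x\<in>koethe_space u. koethe_seminorm w k (T x) \<le> C * koethe_seminorm u l x"
      using bound[OF k(1)] by blast
    let ?B = "{y \<in> koethe_space u. koethe_seminorm u l (\<lambda>n. y n - x n) < \<epsilon> / C}"
    have "T y \<in> V" if y: "y \<in> ?B" for y
    proof -
      have "koethe_seminorm w k (T (\<lambda>n. y n - x n)) \<le> C * koethe_seminorm u l (\<lambda>n. y n - x n)"
        using C u.koethe_space_diff[of y x] y x by blast
      also have "\<dots> < \<epsilon>"
        using y l(2) by (simp add: field_simps)
      finally show ?thesis
        using ball_V y x diff[of y x] maps by auto
    qed
    moreover have "openin (koethe_topology u) ?B" "x \<in> ?B"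
      using u.openin_koethe_ball[OF x(1) l(1), of "\<epsilon> / C"] k(2) l(2) x(1)
      by (simp_all add: koethe_seminorm_def)
    ultimately show "\<exists>U. openin (koethe_topology u) U \<and> x \<in> U
        \<and> U \<subseteq> {x \<in> koethe_space u. T x \<in> V}"
      by (intro exI[of _ ?B]) auto
  qed
  then show ?thesis
    unfolding continuous_map_def using maps by auto
qed

section \<open>Hankel operators between Koethe spaces\<close>

text \<open>The operator computed coordinate by coordinate with scalar series. It is easier to
  estimate than the limit in the target topology, with which it is identified afterwards.\<close>

definition hankel_sum :: "(nat \<Rightarrow> 'a::real_normed_field) \<Rightarrow> (nat \<Rightarrow> 'a) \<Rightarrow> nat \<Rightarrow> 'a" where
  "hankel_sum \<theta> x = (\<lambda>j. \<Sum>n. x n * hankel_column \<theta> n j)"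

text \<open>Turns convergence of the partial sums into continuity of \<open>hankel_sum\<close> along
  the truncations of \<open>x\<close>.\<close>

lemma hankel_sum_truncation:
  "hankel_sum \<theta> (\<lambda>n. if n < N then x n else 0) = hankel_partial_sum \<theta> x N"
proof
  fix j
  have "hankel_sum \<theta> (\<lambda>n. if n < N then x n else 0) j
      = (\<Sum>n<N. (if n < N then x n else 0) * hankel_column \<theta> n j)"
    unfolding hankel_sum_def by (rule suminf_finite) auto
  then show "hankel_sum \<theta> (\<lambda>n. if n < N then x n else 0) j = hankel_partial_sum \<theta> x N j"
    by (simp add: hankel_partial_sum_def)
qed

text \<open>Finite sums over \<open>j\<close> make the bound include the summability of the columns.
  One index \<open>l\<close> serves all \<open>k\<close>, which is what later yields compactness and
  not just continuity.\<close>

locale hankel_matrix_bound =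
  u: koethe_matrix u + w: koethe_matrix w for u w +
  fixes \<theta> :: "nat \<Rightarrow> 'a::{real_normed_field, heine_borel}" and l :: nat and C :: "nat \<Rightarrow> real"
  assumes l: "1 \<le> l"
    and C_pos: "\<And>k. 0 < C k"
    and column_bound:
      "\<And>k n J. 1 \<le> k \<Longrightarrow> (\<Sum>j<J. norm (hankel_column \<theta> n j) * w k j) \<le> C k * u l n"
begin

lemma hankel_column_in_koethe_space: "hankel_column \<theta> n \<in> koethe_space w"
  unfolding koethe_space_def
  by (auto intro!: summableI_nonneg_bounded[OF _ column_bound])

lemma summable_norm_hankel_sum:
  assumes x: "x \<in> koethe_space u"
  shows "summable (\<lambda>n. norm (x n * hankel_column \<theta> n j))"
proof (rule summable_comparison_test'[of _ 0])
  show "summable (\<lambda>n. (C 1 / w 1 j) * (norm (x n) * u l n))"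
    by (intro summable_mult u.summable_koethe x l)
  show "norm (norm (x n * hankel_column \<theta> n j)) \<le> (C 1 / w 1 j) * (norm (x n) * u l n)" for n
  proof -
    \<comment> \<open>The entry at \<open>j\<close> is isolated as one summand of the bounded
      partial sum of length \<open>Suc j\<close>.\<close>
    have "norm (hankel_column \<theta> n j) * w 1 j \<le> (\<Sum>i<Suc j. norm (hankel_column \<theta> n i) * w 1 i)"
      by (rule member_le_sum) auto
    also have "\<dots> \<le> C 1 * u l n"
      by (rule column_bound) simp
    finally have "norm (hankel_column \<theta> n j) \<le> C 1 / w 1 j * u l n"
      using w.weight_pos[of 1 j] by (simp add: field_simps)
    then have "norm (x n) * norm (hankel_column \<theta> n j) \<le> norm (x n) * (C 1 / w 1 j * u l n)"
      by (intro mult_left_mono) auto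
    then show ?thesis
      by (simp add: norm_mult mult_ac)
  qed
qed

lemma summable_hankel_sum:
  "x \<in> koethe_space u \<Longrightarrow> summable (\<lambda>n. x n * hankel_column \<theta> n j)"
  by (rule summable_norm_cancel_complete[OF summable_norm_hankel_sum])

lemma norm_hankel_sum_le:
  assumes x: "x \<in> koethe_space u"
  shows "norm (hankel_sum \<theta> x j) \<le> (\<Sum>n. norm (x n * hankel_column \<theta> n j))"
proof (rule LIMSEQ_le)
  show "(\<lambda>N. norm (\<Sum>n<N. x n * hankel_column \<theta> n j)) \<longlonglongrightarrow> norm (hankel_sum \<theta> x j)"
    unfolding hankel_sum_def
    by (intro tendsto_norm summable_LIMSEQ summable_hankel_sum x)
  show "(\<lambda>N. \<Sum>n<N. norm (x n * hankel_column \<theta> n j))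
      \<longlonglongrightarrow> (\<Sum>n. norm (x n * hankel_column \<theta> n j))"
    by (intro summable_LIMSEQ summable_norm_hankel_sum x)
qed (auto intro: norm_sum)

text \<open>With only finitely many \<open>j\<close>, the interchange with the series over
  \<open>n\<close> is linearity of convergent series. The bound is uniform in \<open>J\<close>, so
  it gives both membership in the target and the seminorm estimate.\<close>

lemma sum_hankel_sum_le:
  assumes x: "x \<in> koethe_space u" and k: "1 \<le> k"
  shows "(\<Sum>j<J. norm (hankel_sum \<theta> x j) * w k j) \<le> C k * koethe_seminorm u l x"
proof -
  have sm: "summable (\<lambda>n. norm (x n * hankel_column \<theta> n j) * w k j)" for j
    by (intro summable_mult2 summable_norm_hankel_sum x)
  have "(\<Sum>j<J. norm (hankel_sum \<theta> x j) * w k j)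
      \<le> (\<Sum>j<J. (\<Sum>n. norm (x n * hankel_column \<theta> n j)) * w k j)"
    using w.weight_pos[of k] by (intro sum_mono mult_right_mono norm_hankel_sum_le x) (simp add: less_imp_le)
  also have "\<dots> = (\<Sum>j<J. \<Sum>n. norm (x n * hankel_column \<theta> n j) * w k j)"
    by (intro sum.cong refl suminf_mult2 summable_norm_hankel_sum x)
  also have "\<dots> = (\<Sum>n. \<Sum>j<J. norm (x n * hankel_column \<theta> n j) * w k j)"
    by (rule suminf_sum[symmetric]) (rule sm)
  also have "\<dots> \<le> (\<Sum>n. C k * (norm (x n) * u l n))"
  proof (rule suminf_le)
    show "(\<Sum>j<J. norm (x n * hankel_column \<theta> n j) * w k j) \<le> C k * (norm (x n) * u l n)" for n
    proof -
      have "(\<Sum>j<J. norm (x n * hankel_column \<theta> n j) * w k j)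
          = norm (x n) * (\<Sum>j<J. norm (hankel_column \<theta> n j) * w k j)"
        by (simp add: norm_mult sum_distrib_left mult.assoc)
      also have "\<dots> \<le> norm (x n) * (C k * u l n)"
        by (intro mult_left_mono column_bound k) simp
      finally show ?thesis
        by (simp add: mult_ac)
    qed
    show "summable (\<lambda>n. \<Sum>j<J. norm (x n * hankel_column \<theta> n j) * w k j)"
      by (intro summable_sum sm)
    show "summable (\<lambda>n. C k * (norm (x n) * u l n))"
      by (intro summable_mult u.summable_koethe x l)
  qed
  also have "\<dots> = C k * koethe_seminorm u l x"
    unfolding koethe_seminorm_def by (intro suminf_mult u.summable_koethe x l)
  finally show ?thesis .
qed

lemma hankel_sum_in_koethe_space: "x \<in> koethe_space u \<Longrightarrow> hankel_sum \<theta> x \<in> koethe_space w"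
  unfolding koethe_space_def[of w]
  by (auto intro!: summableI_nonneg_bounded[OF _ sum_hankel_sum_le])

lemma koethe_seminorm_hankel_sum_le:
  assumes "x \<in> koethe_space u" "1 \<le> k"
  shows "koethe_seminorm w k (hankel_sum \<theta> x) \<le> C k * koethe_seminorm u l x"
  unfolding koethe_seminorm_def[of w]
  by (intro suminf_le_const w.summable_koethe hankel_sum_in_koethe_space sum_hankel_sum_le assms)

lemma hankel_sum_add:
  assumes "x \<in> koethe_space u" "y \<in> koethe_space u"
  shows "hankel_sum \<theta> (\<lambda>n. x n + y n) = (\<lambda>j. hankel_sum \<theta> x j + hankel_sum \<theta> y j)"
  unfolding hankel_sum_def
  by (simp add: suminf_add summable_hankel_sum assms distrib_right)

lemma hankel_sum_scale:
  assumes "x \<in> koethe_space u"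
  shows "hankel_sum \<theta> (\<lambda>n. c * x n) = (\<lambda>j. c * hankel_sum \<theta> x j)"
  unfolding hankel_sum_def
  by (simp only: mult.assoc suminf_mult[OF summable_hankel_sum[OF assms]])

lemma hankel_sum_diff:
  assumes "x \<in> koethe_space u" "y \<in> koethe_space u"
  shows "hankel_sum \<theta> (\<lambda>n. x n - y n) = (\<lambda>j. hankel_sum \<theta> x j - hankel_sum \<theta> y j)"
  using hankel_sum_add[OF assms(1) u.koethe_space_scale[OF assms(2), of "-1"]]
    hankel_sum_scale[OF assms(2), of "-1"] by simp

lemma continuous_map_hankel_sum:
  "continuous_map (koethe_topology u) (koethe_topology w) (hankel_sum \<theta>)"
proof (rule continuous_map_koethe)
  show "\<exists>l'\<ge>1. \<exists>D>0. \<forall>x\<in>koethe_space u.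
      koethe_seminorm w k (hankel_sum \<theta> x) \<le> D * koethe_seminorm u l' x" if "1 \<le> k" for k
    using l C_pos koethe_seminorm_hankel_sum_le that by blast
qed (auto intro: u.koethe_matrix_axioms w.koethe_matrix_axioms
    simp: hankel_sum_in_koethe_space hankel_sum_diff)

text \<open>The truncations converge to \<open>x\<close>, and continuity carries this over to their
  images, the partial sums.\<close>

lemma limitin_hankel_partial_sum:
  assumes "x \<in> koethe_space u"
  shows "limitin (koethe_topology w) (hankel_partial_sum \<theta> x) (hankel_sum \<theta> x) sequentially"
  using continuous_map_limit[OF continuous_map_hankel_sum u.limitin_koethe_truncation[OF assms]]
  by (simp add: o_def hankel_sum_truncation)

lemma hankel_operator_eq_hankel_sum:
  assumes "x \<in> koethe_space u"
  shows "hankel_operator (koethe_topology w) \<theta> x = hankel_sum \<theta> x"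
  unfolding hankel_operator_def
  using limitin_hankel_partial_sum[OF assms] w.limitin_koethe_unique by blast

lemma hankel_well_defined_koethe: "hankel_well_defined (koethe_topology u) (koethe_topology w) \<theta>"
  unfolding hankel_well_defined_def
  using hankel_column_in_koethe_space limitin_hankel_partial_sum by auto

lemma continuous_map_hankel_operator:
  "continuous_map (koethe_topology u) (koethe_topology w) (hankel_operator (koethe_topology w) \<theta>)"
  by (rule continuous_map_eq[OF continuous_map_hankel_sum])
    (simp add: hankel_operator_eq_hankel_sum)

text \<open>The open unit ball of the single seminorm of index \<open>l\<close> has its image
  bounded by \<open>C k\<close> in every seminorm \<open>k\<close>, hence precompact.\<close>

lemma compact_linear_map_hankel_operator:
  assumes small: "\<And>k. 1 \<le> k \<Longrightarrow> \<exists>l\<ge>1. (\<lambda>n. w k n / w l n) \<longlonglongrightarrow> 0"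
  shows "compact_linear_map (koethe_topology u) (koethe_topology w)
    (hankel_operator (koethe_topology w) \<theta>)"
proof -
  let ?T = "hankel_operator (koethe_topology w) \<theta>"
  let ?U = "{x :: nat \<Rightarrow> 'a. x \<in> koethe_space u \<and> koethe_seminorm u l x < 1}"
  have "linear_map_between (koethe_topology u) (koethe_topology w) ?T"
    unfolding linear_map_between_def
    by (simp add: hankel_operator_eq_hankel_sum hankel_sum_in_koethe_space hankel_sum_add
        hankel_sum_scale u.koethe_space_add u.koethe_space_scale)
  moreover have "zero_neighbourhood (koethe_topology u) ?U"
    using l by (intro u.zero_neighbourhood_koethe_ball) auto
  moreover have "precompact_in (koethe_topology w) (?T ` ?U)"
  proof (rule w.precompact_in_koethe_if_bounded[OF _ _ small])
    show "?T ` ?U \<subseteq> koethe_space w"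
      by (auto simp: hankel_operator_eq_hankel_sum hankel_sum_in_koethe_space)
    fix k :: nat assume k: "1 \<le> k"
    have "koethe_seminorm w k (?T x) \<le> C k" if x: "x \<in> ?U" for x
    proof -
      have "koethe_seminorm w k (?T x) \<le> C k * koethe_seminorm u l x"
        using x k by (simp add: hankel_operator_eq_hankel_sum koethe_seminorm_hankel_sum_le)
      also have "\<dots> \<le> C k * 1"
        using x C_pos[of k] by (intro mult_left_mono) auto
      finally show ?thesis
        by simp
    qed
    then show "\<exists>C. \<forall>y\<in>?T ` ?U. koethe_seminorm w k y \<le> C"
      by blast
  qed auto
  ultimately show ?thesis
    unfolding compact_linear_map_def by blast
qed

end

section \<open>The column estimate for power series spaces\<close>

lemma hankel_matrix_bound_power_series:
  fixes \<alpha> \<beta> :: "nat \<Rightarrow> real" and \<theta> :: "nat \<Rightarrow> 'a::{real_normed_field, heine_borel}"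
  assumes \<beta>: "\<And>n. 0 \<le> \<beta> n" "mono \<beta>" and \<alpha>: "\<And>n. 0 \<le> \<alpha> n"
    and le: "\<And>n. \<alpha> n \<le> A * \<beta> n + B"
    and \<theta>: "\<theta> \<in> inf_power_series_space \<beta>"
  shows "\<exists>C. hankel_matrix_bound (\<lambda>k n. exp (- (1 / real k) * \<alpha> n)) (\<lambda>k n. exp (real k * \<beta> n)) \<theta> 1 C"
proof -
  interpret u: koethe_matrix "\<lambda>k n. exp (- (1 / real k) * \<alpha> n)"
    by (rule koethe_matrix_fin) fact
  interpret w: koethe_matrix "\<lambda>k n. exp (real k * \<beta> n)"
    by (rule koethe_matrix_inf) fact
  \<comment> \<open>Seminorm indices are integers, so \<open>A\<close> is rounded up to
    \<open>m\<close> to make \<open>k + m\<close> an admissible index.\<close>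
  obtain m :: nat where m: "A \<le> real m"
    using real_arch_simple by blast
  define R where "R = (\<lambda>k. \<Sum>j. norm (\<theta> j) * exp (real (k + m) * \<beta> j))"
  \<comment> \<open>The absolute value and the summand 1 give positivity for every \<open>k\<close>
    without discussing the sign of \<open>R k\<close>.\<close>
  define C where "C = (\<lambda>k. \<bar>R k\<bar> * exp B + 1)"
  have "(\<Sum>j<J. norm (hankel_column \<theta> n j) * exp (real k * \<beta> j)) \<le> C k * exp (- (1 / real 1) * \<alpha> n)"
    if k: "1 \<le> k" for k n J
  proof -
    have sm: "summable (\<lambda>j. norm (\<theta> j) * exp (real (k + m) * \<beta> j))"
      using \<theta> k unfolding inf_power_series_space_def by (blast intro: trans_le_add1)
    have term_le: "norm (hankel_column \<theta> n j) * exp (real k * \<beta> j)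
        \<le> norm (\<theta> (j + n)) * exp (real (k + m) * \<beta> (j + n)) * exp (B - \<alpha> n)" for j
    proof -
      \<comment> \<open>The exponent at \<open>j + n\<close> dominates both others: its share
        \<open>k\<close> pays for the weight at \<open>j\<close>, its share \<open>m\<close> for the
        decay in \<open>n\<close>.\<close>
      have "\<beta> j \<le> \<beta> (j + n)" "\<beta> n \<le> \<beta> (j + n)"
        using \<beta>(2) by (simp_all add: monoD)
      then have "real k * \<beta> j \<le> real k * \<beta> (j + n)" "real m * \<beta> n \<le> real m * \<beta> (j + n)"
        by (simp_all add: mult_left_mono)
      moreover have "\<alpha> n - B \<le> real m * \<beta> n"
        using le[of n] mult_right_mono[OF m \<beta>(1)[of n]] by linarith
      ultimately have "real k * \<beta> j \<le> real (k + m) * \<beta> (j + n) + (B - \<alpha> n)"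
        by (simp add: distrib_right)
      then have "exp (real k * \<beta> j) \<le> exp (real (k + m) * \<beta> (j + n)) * exp (B - \<alpha> n)"
        by (simp flip: exp_add)
      then show ?thesis
        by (simp add: hankel_column_def mult_left_mono mult.assoc)
    qed
    \<comment> \<open>After the shift by \<open>n\<close> the sum is a block of the series for the
      seminorm of \<open>\<theta>\<close> with index \<open>k + m\<close>.\<close>
    have "(\<Sum>j<J. norm (\<theta> (j + n)) * exp (real (k + m) * \<beta> (j + n)))
        = (\<Sum>i\<in>{n..<J + n}. norm (\<theta> i) * exp (real (k + m) * \<beta> i))"
      by (rule sum.reindex_bij_witness[of _ "\<lambda>i. i - n" "\<lambda>j. j + n"]) auto
    also have "\<dots> \<le> R k"
      unfolding R_def by (rule sum_le_suminf[OF sm]) auto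
    finally have "(\<Sum>j<J. norm (\<theta> (j + n)) * exp (real (k + m) * \<beta> (j + n))) * exp (B - \<alpha> n)
        \<le> R k * exp (B - \<alpha> n)"
      by (simp add: mult_right_mono)
    moreover have "(\<Sum>j<J. norm (hankel_column \<theta> n j) * exp (real k * \<beta> j))
        \<le> (\<Sum>j<J. norm (\<theta> (j + n)) * exp (real (k + m) * \<beta> (j + n))) * exp (B - \<alpha> n)"
      unfolding sum_distrib_right by (intro sum_mono term_le)
    ultimately have "(\<Sum>j<J. norm (hankel_column \<theta> n j) * exp (real k * \<beta> j))
        \<le> R k * exp (B - \<alpha> n)"
      by (rule order_trans[rotated])
    also have "\<dots> = R k * exp B * exp (- \<alpha> n)"
      by (simp add: exp_diff exp_minus divide_simps)
    also have "\<dots> \<le> C k * exp (- \<alpha> n)"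
      unfolding C_def by (intro mult_right_mono) (auto intro: add_increasing2 mult_right_mono)
    finally show ?thesis
      by simp
  qed
  moreover have "0 < C k" for k
    unfolding C_def by (simp add: add_nonneg_pos)
  ultimately have "hankel_matrix_bound (\<lambda>k n. exp (- (1 / real k) * \<alpha> n))
      (\<lambda>k n. exp (real k * \<beta> n)) \<theta> 1 C"
    by unfold_locales auto
  then show ?thesis
    by blast
qed

theorem theorem3p8:
  fixes \<beta> \<alpha> :: "nat \<Rightarrow> real"
    and \<theta> :: "nat \<Rightarrow> 'a::{real_normed_field, heine_borel}"
  assumes "\<forall>n. 0 \<le> \<beta> n" and "mono \<beta>" and "filterlim \<beta> at_top sequentially"
    and "\<forall>n. 0 \<le> \<alpha> n" and "mono \<alpha>" and "filterlim \<alpha> at_top sequentially"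
    and "\<exists>A>0. \<exists>B>0. \<forall>n. \<alpha> n \<le> A * \<beta> n + B"
    and "\<theta> \<in> inf_power_series_space \<beta>"
  shows "hankel_well_defined (Lambda_1 \<alpha>) (Lambda_inf \<beta>) \<theta> \<and>
    continuous_map (Lambda_1 \<alpha>) (Lambda_inf \<beta>) (hankel_operator (Lambda_inf \<beta>) \<theta>) \<and>
    compact_linear_map (Lambda_1 \<alpha>) (Lambda_inf \<beta>) (hankel_operator (Lambda_inf \<beta>) \<theta>)"
proof -
  let ?u = "\<lambda>k n. exp (- (1 / real k) * \<alpha> n)" and ?w = "\<lambda>k n. exp (real k * \<beta> n)"
  obtain A B where "\<And>n. \<alpha> n \<le> A * \<beta> n + B"
    using assms(7) by blast
  then obtain C where "hankel_matrix_bound ?u ?w \<theta> 1 C"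
    using hankel_matrix_bound_power_series[of \<beta> \<alpha> A B \<theta>] assms(1,2,4,8) by blast
  then interpret hankel_matrix_bound ?u ?w \<theta> 1 C .
  \<comment> \<open>Passing to the next index suffices: the weight quotient is
    \<open>exp (- \<beta> n)\<close>, which tends to 0 because \<open>\<beta>\<close> tends to
    infinity.\<close>
  have "(\<lambda>n. ?w k n / ?w (Suc k) n) \<longlonglongrightarrow> 0" for k
  proof -
    have "(\<lambda>n. exp (- \<beta> n)) \<longlonglongrightarrow> 0"
      by (intro filterlim_compose[OF exp_at_bot]) (use assms(3) in \<open>simp add: filterlim_uminus_at_top\<close>)
    moreover have "?w k n / ?w (Suc k) n = exp (- \<beta> n)" for n
      by (simp add: distrib_right flip: exp_diff)
    ultimately show ?thesis
      by simp
  qed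
  then have "\<exists>l\<ge>1. (\<lambda>n. ?w k n / ?w l n) \<longlonglongrightarrow> 0" for k
    by (intro exI[of _ "Suc k"]) auto
  then show ?thesis
    unfolding Lambda_1_koethe Lambda_inf_koethe
    by (intro conjI hankel_well_defined_koethe continuous_map_hankel_operator
        compact_linear_map_hankel_operator)
qed

end
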